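(* Let $n \ge 2$ and $m \ge 1$ be integers, and let $\{x_0, x_1, \ldots, x_m\}$ be a set of $m+1$ distinct points of the Hamming cube $H_n$ (it is not assumed that $x_0$ is the zero vector). Then $\det(D) \neq 0$ if and only if the vectors $x_0, x_1, \ldots, x_m$ are affinely independent in $\mathbb{R}^n$.
   Context: $H_n$ is the set $\{0,1\}^n \subset \mathbb{R}^n$ with the metric $d(x,y) = \|x-y\|_1 = \sum_{k=1}^n |x_k - y_k|$. $D = (d(x_i,x_j))_{i,j=0}^m$ is the $(m+1)\times(m+1)$ distance matrix. *)

theory Defs
  imports "HOL-Analysis.Analysis" "Jordan_Normal_Form.Determinant"
begin

text \<open>
  The Hamming cube in dimension \<open>n = CARD('n)\<close>. Components are written with
  \<^const>\<open>vec_nth\<close> because the infix \<open>$\<close> is also used for the other vector type in scope.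
\<close>

definition hamming_cube :: "(real ^ 'n) set" where
  "hamming_cube = {x. \<forall>k. vec_nth x k \<in> {0, 1}}"

definition l1_dist :: "real ^ 'n \<Rightarrow> real ^ 'n \<Rightarrow> real" where
  "l1_dist x y = (\<Sum>k\<in>UNIV. \<bar>vec_nth x k - vec_nth y k\<bar>)"

definition distance_matrix :: "nat \<Rightarrow> (nat \<Rightarrow> real ^ 'n) \<Rightarrow> real mat" where
  "distance_matrix m x = mat (m + 1) (m + 1) (\<lambda>(i, j). l1_dist (x i) (x j))"

end

theory Submission
  imports Defs
begin

text \<open>
  The map \<open>y p = 2 p - 1\<close> sends the cube to \<open>{-1, 1}\<^sup>n\<close>, where the distance becomes
  \<open>(n - y p \<bullet> y q) / 2\<close>. Let \<open>v\<close> be in the kernel of the distance matrix and put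
  \<open>s = \<Sum> v q\<close>, \<open>w = \<Sum> v q y q\<close>. Then \<open>y p \<bullet> w = n s\<close> for every point \<open>p\<close>, hence
  \<open>\<parallel>w\<parallel>\<^sup>2 = n s\<^sup>2\<close>. If \<open>s \<noteq> 0\<close>, this is the equality case of Cauchy-Schwarz and every \<open>y p\<close> equals
  \<open>w / s\<close>, which is impossible for two distinct points. So \<open>s = 0\<close> and \<open>w = 0\<close>, and
  the kernel consists exactly of the affine dependencies.
\<close>

text \<open>All cube points get the same norm under this map, so distances become an affine function
  of inner products.\<close>

definition sign_vector :: "real ^ 'n \<Rightarrow> real ^ 'n" where
  "sign_vector p = 2 *\<^sub>R p - 1"

lemma sign_vector_inject: "sign_vector p = sign_vector q \<longleftrightarrow> p = q"
  by (simp add: sign_vector_def)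

lemma inner_sign_vector_self:
  fixes p :: "real ^ 'n"
  assumes "p \<in> hamming_cube"
  shows "sign_vector p \<bullet> sign_vector p = real CARD('n)"
proof -
  have "vec_nth (sign_vector p) k * vec_nth (sign_vector p) k = 1" for k
  proof -
    have "vec_nth p k \<in> {0, 1}"
      using assms by (simp add: hamming_cube_def)
    then show ?thesis
      by (auto simp: sign_vector_def)
  qed
  then show ?thesis
    by (simp add: inner_vec_def)
qed

lemma l1_dist_hamming_cube:
  fixes p q :: "real ^ 'n"
  assumes "p \<in> hamming_cube" "q \<in> hamming_cube"
  shows "l1_dist p q = (real CARD('n) - sign_vector p \<bullet> sign_vector q) / 2"
proof -
  have "\<bar>vec_nth p k - vec_nth q k\<bar>
      = (1 - vec_nth (sign_vector p) k * vec_nth (sign_vector q) k) / 2" for k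
  proof -
    have "vec_nth p k \<in> {0, 1}" "vec_nth q k \<in> {0, 1}"
      using assms by (simp_all add: hamming_cube_def)
    then show ?thesis
      by (auto simp: sign_vector_def)
  qed
  then show ?thesis
    unfolding l1_dist_def inner_vec_def
    by (simp only: sum_subtractf flip: sum_divide_distrib) simp
qed

text \<open>The right-hand side is the condition on coefficients in
  \<open>affine_dependent_explicit_finite\<close>. The points \<open>p\<close> and \<open>q\<close>
  serve to exclude a nonzero coefficient sum.\<close>

lemma sum_l1_dist_eq_0_iff:
  fixes P :: "(real ^ 'n) set"
  assumes "P \<subseteq> hamming_cube" "p \<in> P" "q \<in> P" "p \<noteq> q"
  shows "(\<forall>a\<in>P. (\<Sum>b\<in>P. l1_dist a b * v b) = 0)
    \<longleftrightarrow> sum v P = 0 \<and> (\<Sum>b\<in>P. v b *\<^sub>R b) = 0"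
proof -
  define n where "n = real CARD('n)"
  define s where "s = sum v P"
  define w where "w = (\<Sum>b\<in>P. v b *\<^sub>R sign_vector b)"
  \<comment> \<open>Once \<open>s = 0\<close>, this makes \<open>w\<close> twice the weighted sum of
    the original points, so the two vanish together.\<close>
  have w: "w = 2 *\<^sub>R (\<Sum>b\<in>P. v b *\<^sub>R b) - s *\<^sub>R 1"
    by (simp add: w_def s_def sign_vector_def scaleR_right_diff_distrib sum_subtractf
        scaleR_sum_right scaleR_sum_left mult.commute)
  have row: "(\<Sum>b\<in>P. l1_dist a b * v b) = (n * s - sign_vector a \<bullet> w) / 2" if "a \<in> P" for a
  proof -
    have "(\<Sum>b\<in>P. l1_dist a b * v b)
        = (\<Sum>b\<in>P. (n * v b - v b * (sign_vector a \<bullet> sign_vector b)) / 2)"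
      using that assms(1)
      by (intro sum.cong) (auto simp: l1_dist_hamming_cube n_def subset_iff algebra_simps)
    also have "\<dots> = (n * s - sign_vector a \<bullet> w) / 2"
      by (simp add: s_def w_def inner_sum_right sum_subtractf sum_distrib_left
          flip: sum_divide_distrib)
    finally show ?thesis .
  qed
  show ?thesis
  proof
    assume "\<forall>a\<in>P. (\<Sum>b\<in>P. l1_dist a b * v b) = 0"
    then have aw: "sign_vector a \<bullet> w = n * s" if "a \<in> P" for a
      using row that by simp
    \<comment> \<open>Only the left factor is expanded, so that \<open>aw\<close> evaluates each
      term.\<close>
    have "w \<bullet> w = (\<Sum>b\<in>P. v b * (sign_vector b \<bullet> w))"
      by (subst w_def) (simp add: inner_sum_left)
    also have "\<dots> = n * s * s"
      by (simp add: aw s_def sum_distrib_right mult.commute)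
    finally have ww: "w \<bullet> w = n * s * s" .
    have "s = 0"
    proof (rule ccontr)
      assume "s \<noteq> 0"
      have "s *\<^sub>R sign_vector a = w" if "a \<in> P" for a
      proof -
        have "sign_vector a \<bullet> sign_vector a = n"
          using inner_sign_vector_self that assms(1) by (auto simp: n_def)
        \<comment> \<open>The square expands to
          \<open>s * s * n - 2 * s * (n * s) + n * s * s\<close>.\<close>
        then have "(s *\<^sub>R sign_vector a - w) \<bullet> (s *\<^sub>R sign_vector a - w) = 0"
          using aw[OF that] ww by (simp add: algebra_simps inner_commute)
        then show ?thesis
          by simp
      qed
      then have "s *\<^sub>R sign_vector p = s *\<^sub>R sign_vector q"
        using assms by simp
      with \<open>s \<noteq> 0\<close> \<open>p \<noteq> q\<close> show False
        by (simp add: sign_vector_inject)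
    qed
    with ww w show "sum v P = 0 \<and> (\<Sum>b\<in>P. v b *\<^sub>R b) = 0"
      by (simp add: s_def)
  next
    assume "sum v P = 0 \<and> (\<Sum>b\<in>P. v b *\<^sub>R b) = 0"
    then show "\<forall>a\<in>P. (\<Sum>b\<in>P. l1_dist a b * v b) = 0"
      using row w by (simp add: s_def)
  qed
qed

text \<open>A singular matrix has a nonzero kernel vector; injectivity of \<open>x\<close> lets its
  entries be indexed by points instead of positions, the form in which affine dependence is
  expressed.\<close>

lemma det_distance_matrix_eq_0_iff:
  assumes "inj_on x {0..m}"
  shows "Determinant.det (distance_matrix m x) = 0 \<longleftrightarrow>
    (\<exists>v. (\<exists>a \<in> x ` {0..m}. v a \<noteq> 0) \<and>
      (\<forall>a \<in> x ` {0..m}. (\<Sum>b \<in> x ` {0..m}. l1_dist a b * v b) = 0))"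
    (is "_ \<longleftrightarrow> (\<exists>v. ?Q v)")
proof -
  let ?D = "distance_matrix m x"
  have D: "?D \<in> carrier_mat (Suc m) (Suc m)"
    by (simp add: distance_matrix_def)
  \<comment> \<open>\<open>u\<close> and \<open>v\<close> are tied only by their values at the
    points, so both directions below can use this.\<close>
  have kernel: "u \<noteq> 0\<^sub>v (Suc m) \<and> ?D *\<^sub>v u = 0\<^sub>v (Suc m) \<longleftrightarrow> ?Q v"
    if u: "u \<in> carrier_vec (Suc m)" and vec: "\<And>i. i \<le> m \<Longrightarrow> vec_index u i = v (x i)" for u v
  proof -
    have "vec_index (?D *\<^sub>v u) i = (\<Sum>b \<in> x ` {0..m}. l1_dist (x i) b * v b)" if "i \<le> m" for i
    proof -
      have "vec_index (?D *\<^sub>v u) i = (\<Sum>j\<in>{0..<Suc m}. l1_dist (x i) (x j) * vec_index u j)"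
        using that u by (simp add: distance_matrix_def scalar_prod_def)
      also have "\<dots> = (\<Sum>j\<in>{0..m}. l1_dist (x i) (x j) * v (x j))"
        by (intro sum.cong) (auto simp: vec)
      finally show ?thesis
        by (simp add: sum.reindex[OF assms])
    qed
    moreover have "dim_vec (?D *\<^sub>v u) = Suc m"
      by (simp add: distance_matrix_def)
    ultimately have "?D *\<^sub>v u = 0\<^sub>v (Suc m) \<longleftrightarrow>
        (\<forall>i\<le>m. (\<Sum>b \<in> x ` {0..m}. l1_dist (x i) b * v b) = 0)"
      by (simp add: Matrix.vec_eq_iff less_Suc_eq_le)
    moreover have "u \<noteq> 0\<^sub>v (Suc m) \<longleftrightarrow> (\<exists>i\<le>m. v (x i) \<noteq> 0)"
      using u by (auto simp: Matrix.vec_eq_iff less_Suc_eq_le vec)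
    ultimately show ?thesis
      by auto
  qed
  show ?thesis
    unfolding det_0_iff_vec_prod_zero[OF D]
  proof
    assume "\<exists>u. u \<in> carrier_vec (Suc m) \<and> u \<noteq> 0\<^sub>v (Suc m) \<and> ?D *\<^sub>v u = 0\<^sub>v (Suc m)"
    then obtain u where u: "u \<in> carrier_vec (Suc m)" "u \<noteq> 0\<^sub>v (Suc m)" "?D *\<^sub>v u = 0\<^sub>v (Suc m)"
      by blast
    \<comment> \<open>The coefficient of a point is the entry of \<open>u\<close> at its index;
      values off the image of \<open>x\<close> do not matter.\<close>
    have "vec_index u i = vec_index u (the_inv_into {0..m} x (x i))" if "i \<le> m" for i
      using that by (simp add: the_inv_into_f_f[OF assms])
    from kernel[OF u(1) this] u(2,3) have "?Q (\<lambda>a. vec_index u (the_inv_into {0..m} x a))"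
      by blast
    then show "\<exists>v. ?Q v"
      by (rule exI[where x = "\<lambda>a. vec_index u (the_inv_into {0..m} x a)"])
  next
    assume "\<exists>v. ?Q v"
    then obtain v where v: "?Q v"
      by (rule exE)
    define u where "u = Matrix.vec (Suc m) (\<lambda>i. v (x i))"
    have u: "u \<in> carrier_vec (Suc m)" "\<And>i. i \<le> m \<Longrightarrow> vec_index u i = v (x i)"
      by (simp_all add: u_def)
    from kernel[OF u] u(1) v
    show "\<exists>u. u \<in> carrier_vec (Suc m) \<and> u \<noteq> 0\<^sub>v (Suc m) \<and> ?D *\<^sub>v u = 0\<^sub>v (Suc m)"
      by blast
  qed
qed

theorem corollary2p5:
  fixes x :: "nat \<Rightarrow> real ^ 'n" and m :: nat
  assumes "CARD('n) \<ge> 2" and "m \<ge> 1"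
    and "inj_on x {0..m}" and "x ` {0..m} \<subseteq> hamming_cube"
  shows "Determinant.det (distance_matrix m x) \<noteq> 0 \<longleftrightarrow> \<not> affine_dependent (x ` {0..m})"
proof -
  have "x 0 \<in> x ` {0..m}" "x 1 \<in> x ` {0..m}"
    using \<open>m \<ge> 1\<close> by auto
  moreover have "x 0 \<noteq> x 1"
    using assms(2,3) by (auto dest: inj_onD)
  ultimately show ?thesis
    \<comment> \<open>Both sides now speak of a nonzero \<open>v\<close> with the same two
      equations, up to the order of conjuncts.\<close>
    unfolding det_distance_matrix_eq_0_iff[OF assms(3)]
      affine_dependent_explicit_finite[OF finite_imageI[OF finite_atLeastAtMost]]
      sum_l1_dist_eq_0_iff[OF assms(4) \<open>x 0 \<in> _\<close> \<open>x 1 \<in> _\<close> \<open>x 0 \<noteq> x 1\<close>]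
    by blast
qed

end
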